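(* Every subtractive commutative hemiring is a Kuratowski hemiring, and every austere commutative hemiring is a Kuratowski hemiring.
   Context: A (commutative) hemiring $(H,+,\cdot)$ is a set with $(H,+)$ a commutative monoid with identity $0$, $(H,\cdot)$ a commutative semigroup, multiplication distributing over addition, and $0h=0$ for all $h\in H$. No multiplicative identity is assumed. An ideal of $H$ is a nonempty subset $I$ with $a+b\in I$ and $ha\in I$ for all $a,b\in I$, $h\in H$. An ideal $I$ is subtractive if $x+y\in I$ and $x\in I$ imply $y\in I$, for all $x,y\in H$. $\operatorname{Id}(H)$ is the lattice of ideals of $H$ ordered by inclusion, with least element $\{0\}$ and join $I+J=\{i+j: i\in I, j\in J\}$. For $X\subseteq H$, $\operatorname{scl}_H(X)$ is the intersection of all subtractive ideals of $H$ containing $X$. A hemiring is subtractive if all of its ideals are subtractive; it is austere if its only subtractive ideals are $\{0\}$ and $H$. A Kuratowski map on a join-semilattice $(P,\le)$ with least element $0$ is a function $k:P\to P$ such that for all $x,y\in P$: $x\le k(x)$; $k(k(x))=k(x)$; $k(0)=0$; $k(x\vee y)=k(x)\vee k(y)$. A hemiring $H$ is called a Kuratowski hemiring if $\operatorname{scl}_H$, restricted to $\operatorname{Id}(H)$, is a Kuratowski map on $\operatorname{Id}(H)$. *)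

theory Defs
  imports "HOL-Algebra.Lattice" "HOL-Library.Set_Algebras"
begin

text \<open>
  Commutative hemirings, without a multiplicative identity, are the types of class
  \<^class>\<open>comm_semiring_0\<close>. A property of a hemiring is a predicate on its type.
\<close>

definition hemiring_ideal :: "'a::comm_semiring_0 set \<Rightarrow> bool" where
  "hemiring_ideal I \<longleftrightarrow>
     I \<noteq> {} \<and> (\<forall>a\<in>I. \<forall>b\<in>I. a + b \<in> I) \<and> (\<forall>h. \<forall>a\<in>I. h * a \<in> I)"

definition subtractive_ideal :: "'a::comm_semiring_0 set \<Rightarrow> bool" where
  "subtractive_ideal I \<longleftrightarrow>
     hemiring_ideal I \<and> (\<forall>x y. x + y \<in> I \<and> x \<in> I \<longrightarrow> y \<in> I)"

definition Id_lattice :: "'a::comm_semiring_0 set gorder" where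
  "Id_lattice = \<lparr>carrier = {I. hemiring_ideal I}, eq = (=), le = (\<subseteq>)\<rparr>"

definition scl :: "'a::comm_semiring_0 set \<Rightarrow> 'a set" where
  "scl X = \<Inter>{I. subtractive_ideal I \<and> X \<subseteq> I}"

definition subtractive_hemiring :: "'a::comm_semiring_0 itself \<Rightarrow> bool" where
  "subtractive_hemiring H \<longleftrightarrow> (\<forall>I::'a set. hemiring_ideal I \<longrightarrow> subtractive_ideal I)"

text \<open>The zero hemiring is austere: there both ideals below coincide.\<close>

definition austere_hemiring :: "'a::comm_semiring_0 itself \<Rightarrow> bool" where
  "austere_hemiring H \<longleftrightarrow> (\<forall>I::'a set. subtractive_ideal I \<longrightarrow> I = {0} \<or> I = UNIV)"

text \<open>
  Only the restriction of \<open>k\<close> to \<open>carrier L\<close> is constrained. The two parent locales say that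
  \<open>L\<close> is a join-semilattice with a least element.
\<close>

locale kuratowski_map =
  upper_semilattice L + weak_partial_order_bottom L for L (structure) +
  fixes k
  assumes closed: "k \<in> carrier L \<rightarrow> carrier L"
    and extensive: "x \<in> carrier L \<Longrightarrow> x \<sqsubseteq> k x"
    and idem: "x \<in> carrier L \<Longrightarrow> k (k x) = k x"
    and bottom: "k \<bottom> = \<bottom>"
    and join: "\<lbrakk>x \<in> carrier L; y \<in> carrier L\<rbrakk> \<Longrightarrow> k (x \<squnion> y) = k x \<squnion> k y"

definition kuratowski_hemiring :: "'a::comm_semiring_0 itself \<Rightarrow> bool" where
  "kuratowski_hemiring H \<longleftrightarrow> kuratowski_map (Id_lattice :: 'a set gorder) scl"


text \<open>The order-theoretic join and bottom of \<^const>\<open>Id_lattice\<close> are \<open>I + J\<close> and \<open>{0}\<close>.\<close>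

lemma Id_lattice_simps [simp]:
  "I \<in> carrier Id_lattice \<longleftrightarrow> hemiring_ideal I"
  "I .=\<^bsub>Id_lattice\<^esub> J \<longleftrightarrow> I = J"
  "I \<sqsubseteq>\<^bsub>Id_lattice\<^esub> J \<longleftrightarrow> I \<subseteq> J"
  by (simp_all add: Id_lattice_def)

lemma zero_in_ideal: "hemiring_ideal I \<Longrightarrow> 0 \<in> I"
  unfolding hemiring_ideal_def by (metis all_not_in_conv mult_zero_left)

lemma hemiring_ideal_zero: "hemiring_ideal {0}"
  by (simp add: hemiring_ideal_def)

lemma hemiring_ideal_plus:
  assumes "hemiring_ideal I" "hemiring_ideal J"
  shows "hemiring_ideal (I + J)"
  unfolding hemiring_ideal_def
proof (intro conjI ballI allI)
  show "I + J \<noteq> {}"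
    using zero_in_ideal[OF assms(1)] zero_in_ideal[OF assms(2)] by (auto simp: set_plus_def)
next
  fix a b assume "a \<in> I + J" "b \<in> I + J"
  then obtain i j i' j' where *: "i \<in> I" "j \<in> J" "i' \<in> I" "j' \<in> J" "a = i + j" "b = i' + j'"
    by (auto elim!: set_plus_elim)
  then have "a + b = (i + i') + (j + j')" by (simp add: ac_simps)
  then show "a + b \<in> I + J" using * assms by (auto simp: hemiring_ideal_def)
next
  fix h a assume "a \<in> I + J"
  then obtain i j where *: "i \<in> I" "j \<in> J" "a = i + j" by (auto elim!: set_plus_elim)
  then have "h * i \<in> I" "h * j \<in> J" using assms by (auto simp: hemiring_ideal_def)
  then show "h * a \<in> I + J" by (simp add: * distrib_left set_plus_intro)
qed

lemma partial_order_Id: "partial_order (Id_lattice :: 'a::comm_semiring_0 set gorder)"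
  by unfold_locales (auto simp: fun_eq_iff)

lemma least_Upper_Id:
  assumes "hemiring_ideal I" "hemiring_ideal J"
  shows "least Id_lattice (I + J) (Upper Id_lattice {I, J})"
proof -
  have "I \<subseteq> I + J" "J \<subseteq> I + J"
    using zero_in_ideal[OF assms(1)] zero_in_ideal[OF assms(2)]
    by (auto simp: set_plus_def) (metis add_0_right, metis add_0_left)
  moreover have "I + J \<subseteq> K" if "hemiring_ideal K" "I \<subseteq> K" "J \<subseteq> K" for K
    using that by (auto elim!: set_plus_elim simp: hemiring_ideal_def)
  ultimately show ?thesis
    using assms hemiring_ideal_plus[OF assms] by (auto simp: least_def Upper_def)
qed

lemma least_Id: "least Id_lattice {0} (carrier Id_lattice)"
  by (auto simp: least_def hemiring_ideal_zero zero_in_ideal)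

lemma upper_semilattice_Id: "upper_semilattice (Id_lattice :: 'a::comm_semiring_0 set gorder)"
proof -
  interpret partial_order "Id_lattice :: 'a set gorder" by (rule partial_order_Id)
  show ?thesis by unfold_locales (use least_Upper_Id in auto)
qed

lemma weak_partial_order_bottom_Id:
  "weak_partial_order_bottom (Id_lattice :: 'a::comm_semiring_0 set gorder)"
proof -
  interpret partial_order "Id_lattice :: 'a set gorder" by (rule partial_order_Id)
  show ?thesis by unfold_locales (use least_Id in blast)
qed

lemma bottom_Id: "\<bottom>\<^bsub>Id_lattice\<^esub> = ({0} :: 'a::comm_semiring_0 set)"
proof -
  interpret weak_partial_order_bottom "Id_lattice :: 'a set gorder"
    by (rule weak_partial_order_bottom_Id)
  show ?thesis
    using bottom_least least_Id by (metis Id_lattice_simps(2) weak_least_unique)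
qed

lemma join_Id:
  fixes I J :: "'a::comm_semiring_0 set"
  assumes "hemiring_ideal I" "hemiring_ideal J"
  shows "I \<squnion>\<^bsub>Id_lattice\<^esub> J = I + J"
proof -
  interpret partial_order "Id_lattice :: 'a set gorder" by (rule partial_order_Id)
  have "least Id_lattice (I \<squnion>\<^bsub>Id_lattice\<^esub> J) (Upper Id_lattice {I, J})"
    unfolding join_def sup_def using least_Upper_Id[OF assms] by (rule someI)
  then show ?thesis
    using least_Upper_Id[OF assms] by (metis Id_lattice_simps(2) weak_least_unique)
qed

end

theory Submission
  imports Defs
begin

text \<open>
  The map \<^const>\<open>scl\<close> is a closure operator on ideals and fixes \<open>{0}\<close>, because \<open>0 + y = 0\<close> forces
  \<open>y = 0\<close>. So only additivity on joins is at stake. If all ideals are subtractive, \<^const>\<open>scl\<close> is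
  the identity on ideals; in the austere case it sends every nonzero ideal to the whole hemiring,
  and a sum of two ideals is zero only if both are.
\<close>

lemma subtractive_ideal_zero: "subtractive_ideal {0}"
  by (auto simp: subtractive_ideal_def hemiring_ideal_zero)

text \<open>This is what makes \<open>scl X\<close> itself a subtractive ideal. The family may be
  empty; its intersection is then the whole hemiring.\<close>

lemma subtractive_ideal_Inter:
  assumes "\<And>I. I \<in> \<I> \<Longrightarrow> subtractive_ideal I"
  shows "subtractive_ideal (\<Inter>\<I>)"
proof -
  have ideal: "hemiring_ideal I" if "I \<in> \<I>" for I
    using assms[OF that] by (simp add: subtractive_ideal_def)
  then have "0 \<in> \<Inter>\<I>"
    by (simp add: zero_in_ideal)
  moreover have "a + b \<in> \<Inter>\<I>" if "a \<in> \<Inter>\<I>" "b \<in> \<Inter>\<I>" for a b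
    using that ideal by (simp add: hemiring_ideal_def)
  moreover have "h * a \<in> \<Inter>\<I>" if "a \<in> \<Inter>\<I>" for h a
    using that ideal by (simp add: hemiring_ideal_def)
  ultimately have "hemiring_ideal (\<Inter>\<I>)"
    unfolding hemiring_ideal_def by blast
  moreover have "y \<in> \<Inter>\<I>" if "x + y \<in> \<Inter>\<I>" "x \<in> \<Inter>\<I>" for x y
  proof
    fix I assume "I \<in> \<I>"
    with that have "x + y \<in> I" "x \<in> I" by auto
    with assms[OF \<open>I \<in> \<I>\<close>] show "y \<in> I"
      unfolding subtractive_ideal_def by blast
  qed
  ultimately show ?thesis
    unfolding subtractive_ideal_def by blast
qed

lemma subset_scl: "X \<subseteq> scl X"
  by (auto simp: scl_def)

lemma subtractive_ideal_scl: "subtractive_ideal (scl X)"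
  unfolding scl_def by (rule subtractive_ideal_Inter) simp

lemma scl_eq_self: "scl I = I" if "subtractive_ideal I"
  using that by (auto simp: scl_def)

lemma kuratowski_hemiringI:
  assumes "\<And>I J :: 'a::comm_semiring_0 set.
    \<lbrakk>hemiring_ideal I; hemiring_ideal J\<rbrakk> \<Longrightarrow> scl (I + J) = scl I + scl J"
  shows "kuratowski_hemiring TYPE('a)"
proof -
  \<comment> \<open>Besides closedness of the map, this lets \<open>join_Id\<close> turn the join of
    \<open>scl I\<close> and \<open>scl J\<close> into their sum, where the assumption
    applies.\<close>
  have ideal: "hemiring_ideal (scl I)" for I :: "'a set"
    using subtractive_ideal_scl by (auto simp: subtractive_ideal_def)
  show ?thesis
    \<comment> \<open>Idempotence and the value at the bottom both come from
      \<open>scl_eq_self\<close>, since \<open>scl I\<close> and \<open>{0}\<close> are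
      subtractive.\<close>
    unfolding kuratowski_hemiring_def
    by (intro kuratowski_map.intro kuratowski_map_axioms.intro
        upper_semilattice_Id weak_partial_order_bottom_Id)
      (simp_all add: bottom_Id join_Id ideal assms subset_scl scl_eq_self subtractive_ideal_scl
        subtractive_ideal_zero)
qed

lemma subtractive_imp_kuratowski:
  assumes "subtractive_hemiring TYPE('a::comm_semiring_0)"
  shows "kuratowski_hemiring TYPE('a)"
  using assms
  by (intro kuratowski_hemiringI)
    (simp add: subtractive_hemiring_def scl_eq_self hemiring_ideal_plus)

lemma scl_austere:
  fixes I :: "'a::comm_semiring_0 set"
  assumes "austere_hemiring TYPE('a)" and "hemiring_ideal I"
  shows "scl I = (if I = {0} then {0} else UNIV)"
proof (cases "I = {0}")
  case False
  \<comment> \<open>As \<open>I\<close> contains \<open>0\<close>, it has a nonzero element, which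
    survives in \<open>scl I\<close>; austerity then leaves only \<open>UNIV\<close>.\<close>
  then have "\<not> I \<subseteq> {0}"
    using zero_in_ideal[OF assms(2)] by auto
  then have "scl I \<noteq> {0}"
    using subset_scl by metis
  then show ?thesis
    using False assms(1) subtractive_ideal_scl by (auto simp: austere_hemiring_def)
qed (simp add: scl_eq_self subtractive_ideal_zero)

lemma austere_imp_kuratowski:
  assumes "austere_hemiring TYPE('a::comm_semiring_0)"
  shows "kuratowski_hemiring TYPE('a)"
proof (rule kuratowski_hemiringI)
  fix I J :: "'a set"
  assume I: "hemiring_ideal I" and J: "hemiring_ideal J"
  \<comment> \<open>Each summand lies in the join, so a zero sum squeezes both ideals between
    \<open>{0}\<close> and \<open>{0}\<close>.\<close>
  have "I \<subseteq> I + J" "J \<subseteq> I + J"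
    using least_Upper_Id[OF I J] I J by (auto simp: least_def Upper_def)
  then have "I + J = {0} \<longleftrightarrow> I = {0} \<and> J = {0}"
    using zero_in_ideal[OF I] zero_in_ideal[OF J]
    by (metis set_add_0 singletonD subset_singletonD empty_iff)
  \<comment> \<open>Covers the cases where at least one closure is \<open>UNIV\<close>: the other is
    \<open>{0}\<close> or \<open>UNIV\<close> and contains \<open>0\<close>, so the sum is
    everything.\<close>
  moreover have add_UNIV: "UNIV + K = UNIV" "K + UNIV = UNIV" if "0 \<in> K" for K :: "'a set"
    using set_zero_plus2[OF that, of UNIV] by (simp_all add: add.commute top.extremum_unique)
  ultimately show "scl (I + J) = scl I + scl J"
    by (simp add: scl_austere[OF assms] I J hemiring_ideal_plus[OF I J] add_UNIV
        zero_in_ideal)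
qed

theorem proposition3p5:
  shows "(subtractive_hemiring TYPE('a::comm_semiring_0) \<longrightarrow> kuratowski_hemiring TYPE('a)) \<and>
         (austere_hemiring TYPE('a) \<longrightarrow> kuratowski_hemiring TYPE('a))"
  using subtractive_imp_kuratowski austere_imp_kuratowski by blast

end
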